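(* Suppose that the problem $\min_{x\in\mathbb R^{n_x}} f(x)$ with $f(x)=\sum_{i\in\mathcal S}f_i(x_{\mathcal I_i})$ is feasible and that its interaction graph $G$ is a tree with root $1\in\mathcal S$. Let the sets $\mathcal P_i$, the real-valued functions $\tilde V_i:\mathcal P_i\to\mathbb R$ (arbitrary approximations), and the approximate value functions $\bar V_j$ be given as in the FP-ADP algorithm described in the context, and suppose that the minimizers of all $\{\bar V_j\}_{j\in\mathcal S}$ in this algorithm exist. Then the FP-ADP algorithm generates a feasible point of the problem, i.e. a point $\bar x^\star$ with $f(\bar x^\star)<\infty$.
   Context: Problem data. Let $\mathcal S=\{1,\dots,|\mathcal S|\}$ be a finite set of subsystems and $\mathbb R_\infty=\mathbb R\cup\{\infty\}$. For each $i\in\mathcal S$ let $\mathcal I_i\subseteq\{1,\dots,n_x\}$ and $f_i:\mathbb R^{|\mathcal I_i|}\to\mathbb R_\infty$ (constraints are encoded by the value $\infty$). For $x\in\mathbb R^{n_x}$, $x_{\mathcal I}$ is the subvector of components with indices in $\mathcal I$. A point $x$ is feasible if $f(x)<\infty$; the problem is feasible if such a point exists. For an extended real-valued function $g$, $\operatorname{dom}(g)$ is the set of points where $g<\infty$. Graph. In the interaction graph $G$ on $\mathcal S$, distinct $i,j$ are adjacent iff $\mathcal I_i\cap\mathcal I_j\ne\emptyset$. When $G$ is a tree with root $1$, $\operatorname{par}(i)$ is the parent of $i\neq1$ and $\mathcal C_i$ the set of children of $i$. Put $\mathcal W_i=\mathcal I_{\operatorname{par}(i)}\cap\mathcal I_i$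 for $i\ne1$, $\mathcal W_1=\emptyset$, and $\mathcal L_i=\{k\in\mathcal I_i:k\notin\mathcal I_j\ \forall j\neq i\}$. Since $G$ is a tree, $\mathcal I_i$ is the disjoint union of $\mathcal L_i$, $\mathcal W_i$ and $\mathcal W_j$, $j\in\mathcal C_i$, and $f_i(x_{\mathcal I_i})$ is written $f_i(x_{\mathcal L_i},\{x_{\mathcal W_j}\}_{j\in\mathcal C_i\cup\{i\}})$. FP-ADP algorithm (feasibility-preserving approximate dynamic programming). Backward sweep (from the leaves to the root): for each $i\ne1$, once its children have been processed, compute $$\mathcal P_i=\operatorname{proj}_{\mathcal W_i}(\operatorname{dom}(F_i)),\qquad \operatorname{dom}(F_i)=\big\{x_{\mathcal I_i}: f_i(x_{\mathcal I_i})<\infty,\ x_{\mathcal W_k}\in\mathcal P_k\ \forall k\in\mathcal C_i\big\},$$ where $\operatorname{proj}_{\mathcal W_i}(\mathcal X)$ is the set of all subvectors $x_{\mathcal W_i}$ of elements $x_{\mathcal I_i}\in\mathcal X$; choose any real-valued function $\tilde V_i:\mathcal P_i\to\mathbb R$ (an approximation of $\bar V_i$ below); send $(\tilde V_i,\mathcal P_i)$ to the parent. For each $j\in\mathcal S$ define $$\bar V_j(x_{\mathcal W_j})=\min_{x_{\mathcal L_j},\{x_{\mathcal W_i}\}_{i\in\mathcal C_j}} f_j\big(x_{\mathcal L_j},\{x_{\mathcal W_i}\}_{i\in\mathcal C_j\cup\{j\}}\big)+\sum_{i\in\mathcal C_j}\tilde V_i(x_{\mathcal W_i})\quad\text{subject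 to } x_{\mathcal W_i}\in\mathcal P_i\ \forall i\in\mathcal C_j ,$$ where $\bar V_1$ has no argument. Forward sweep (from the root to the leaves): solve the problem defining $\bar V_1$; its minimizer yields $\bar x^\star_{\mathcal L_1}$ and $\bar x^\star_{\mathcal W_i}$, $i\in\mathcal C_1$, which are sent to the children. Then, for each $j\neq1$ after its parent, solve the problem defining $\bar V_j(\bar x^\star_{\mathcal W_j})$ with $\bar x^\star_{\mathcal W_j}$ fixed at the received value; its minimizer yields $\bar x^\star_{\mathcal L_j}$ and $\bar x^\star_{\mathcal W_i}$, $i\in\mathcal C_j$, until all leaves have been solved. The output is the collection of all $\bar x^\star_{\mathcal I_i}$, $i\in\mathcal S$, which together define $\bar x^\star$ (components with an index in no $\mathcal I_i$ are irrelevant). "The minimizers of all $\bar V_j$ exist" means: for every $j\in\mathcal S$ and every $x_{\mathcal W_j}\in\operatorname{dom}(\bar V_j)$ (i.e. every value for which the problem defining $\bar V_j(x_{\mathcal W_j})$ admits a point satisfying the constraints with finite objective), the minimum in $\bar V_j(x_{\mathcal W_j})$ is attained. *)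

theory Defs
  imports
    "Graph_Theory.Digraph_Component"
    "Graph_Theory.Vertex_Walk"
    "HOL-Library.Extended_Real"
    "HOL-Library.FuncSet"
begin

text \<open>
  Subsystems are the numbers \<open>1, \<dots>, N\<close>. A real vector whose components are indexed by a set \<open>A\<close>
  is an extensional function on \<open>A\<close>, and the subvector of \<open>x\<close> with indices in \<open>A\<close> is
  \<open>restrict x A\<close>. Costs are \<open>ereal\<close>-valued; that they avoid \<open>-\<infinity>\<close> is a hypothesis of the theorem.
\<close>

abbreviation vec :: "nat set \<Rightarrow> (nat \<Rightarrow> real) set" where
  "vec A \<equiv> A \<rightarrow>\<^sub>E (UNIV :: real set)"

definition objective ::
    "nat \<Rightarrow> (nat \<Rightarrow> nat set) \<Rightarrow> (nat \<Rightarrow> (nat \<Rightarrow> real) \<Rightarrow> ereal) \<Rightarrow> (nat \<Rightarrow> real) \<Rightarrow> ereal" where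
  "objective N I f x = (\<Sum>i\<in>{1..N}. f i (restrict x (I i)))"

definition feasible ::
    "nat \<Rightarrow> nat \<Rightarrow> (nat \<Rightarrow> nat set) \<Rightarrow> (nat \<Rightarrow> (nat \<Rightarrow> real) \<Rightarrow> ereal) \<Rightarrow> (nat \<Rightarrow> real) \<Rightarrow> bool" where
  "feasible n N I f x \<longleftrightarrow> x \<in> vec {1..n} \<and> objective N I f x < \<infinity>"


section \<open>Interaction graph\<close>

text \<open>An undirected graph is a digraph with a symmetric set of arcs.\<close>

definition interaction_graph :: "nat \<Rightarrow> (nat \<Rightarrow> nat set) \<Rightarrow> nat pair_pre_digraph" where
  "interaction_graph N I =
     \<lparr> pverts = {1..N},
       parcs = {(i, j). i \<in> {1..N} \<and> j \<in> {1..N} \<and> i \<noteq> j \<and> I i \<inter> I j \<noteq> {}} \<rparr>"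

text \<open>
  The library predicate \<open>tree\<close> counts the two opposite arcs of an undirected edge as a cycle and so
  does not apply to symmetric digraphs. Here a cycle is a path on at least three distinct vertices
  whose end points are adjacent.
\<close>

definition undirected_tree :: "'a pair_pre_digraph \<Rightarrow> bool" where
  "undirected_tree G \<longleftrightarrow>
     Digraph_Component.connected (with_proj G) \<and>
     \<not> (\<exists>p. vpath p (with_proj G) \<and> 3 \<le> length p \<and> (last p, hd p) \<in> parcs G)"

text \<open>The parent of \<open>i\<close> is the second vertex of the path from \<open>i\<close> to the root \<open>1\<close>.\<close>

definition parent :: "nat \<Rightarrow> (nat \<Rightarrow> nat set) \<Rightarrow> nat \<Rightarrow> nat" where
  "parent N I i =
     (THE p. \<exists>q. vpath (i # p # q) (with_proj (interaction_graph N I)) \<and> last (i # p # q) = 1)"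

definition children :: "nat \<Rightarrow> (nat \<Rightarrow> nat set) \<Rightarrow> nat \<Rightarrow> nat set" where
  "children N I i = {j \<in> {1..N} - {1}. parent N I j = i}"

definition coupling_idx :: "nat \<Rightarrow> (nat \<Rightarrow> nat set) \<Rightarrow> nat \<Rightarrow> nat set" where
  "coupling_idx N I i = (if i = 1 then {} else I (parent N I i) \<inter> I i)"

definition local_idx :: "nat \<Rightarrow> (nat \<Rightarrow> nat set) \<Rightarrow> nat \<Rightarrow> nat set" where
  "local_idx N I i = {k \<in> I i. \<forall>j\<in>{1..N} - {i}. k \<notin> I j}"


section \<open>Backward sweep\<close>

definition proj :: "nat set \<Rightarrow> (nat \<Rightarrow> real) set \<Rightarrow> (nat \<Rightarrow> real) set" where
  "proj W X = (\<lambda>x. restrict x W) ` X"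

definition dom_F ::
    "nat \<Rightarrow> (nat \<Rightarrow> nat set) \<Rightarrow> (nat \<Rightarrow> (nat \<Rightarrow> real) \<Rightarrow> ereal) \<Rightarrow>
     (nat \<Rightarrow> (nat \<Rightarrow> real) set) \<Rightarrow> nat \<Rightarrow> (nat \<Rightarrow> real) set" where
  "dom_F N I f P i =
     {x \<in> vec (I i). f i x < \<infinity> \<and> (\<forall>k\<in>children N I i. restrict x (coupling_idx N I k) \<in> P k)}"

text \<open>
  On a tree these equations determine \<open>P i\<close> for all \<open>i \<noteq> 1\<close>, from the leaves upwards; the value
  \<open>P 1\<close> is never used.
\<close>

definition backward_sweep ::
    "nat \<Rightarrow> (nat \<Rightarrow> nat set) \<Rightarrow> (nat \<Rightarrow> (nat \<Rightarrow> real) \<Rightarrow> ereal) \<Rightarrow>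
     (nat \<Rightarrow> (nat \<Rightarrow> real) set) \<Rightarrow> bool" where
  "backward_sweep N I f P \<longleftrightarrow>
     (\<forall>i\<in>{1..N} - {1}. P i = proj (coupling_idx N I i) (dom_F N I f P i))"


section \<open>Approximate value functions\<close>

text \<open>
  In the problem of subsystem \<open>j\<close> the argument \<open>w\<close> carries the components in \<open>coupling_idx N I j\<close>
  and the decision \<open>y\<close> all other components of the local vector.
\<close>

definition decision_idx :: "nat \<Rightarrow> (nat \<Rightarrow> nat set) \<Rightarrow> nat \<Rightarrow> nat set" where
  "decision_idx N I j = local_idx N I j \<union> (\<Union>i\<in>children N I j. coupling_idx N I i)"

definition local_vector ::
    "nat \<Rightarrow> (nat \<Rightarrow> nat set) \<Rightarrow> nat \<Rightarrow> (nat \<Rightarrow> real) \<Rightarrow> (nat \<Rightarrow> real) \<Rightarrow> (nat \<Rightarrow> real)" where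
  "local_vector N I j w y = restrict (override_on y w (coupling_idx N I j)) (I j)"

definition stage_constraint ::
    "nat \<Rightarrow> (nat \<Rightarrow> nat set) \<Rightarrow> (nat \<Rightarrow> (nat \<Rightarrow> real) set) \<Rightarrow> nat \<Rightarrow> (nat \<Rightarrow> real) \<Rightarrow> bool" where
  "stage_constraint N I P j y \<longleftrightarrow>
     y \<in> vec (decision_idx N I j) \<and>
     (\<forall>i\<in>children N I j. restrict y (coupling_idx N I i) \<in> P i)"

text \<open>Under \<open>stage_constraint\<close>, each \<open>V i\<close> is evaluated on \<open>P i\<close> only.\<close>

definition stage_cost ::
    "nat \<Rightarrow> (nat \<Rightarrow> nat set) \<Rightarrow> (nat \<Rightarrow> (nat \<Rightarrow> real) \<Rightarrow> ereal) \<Rightarrow>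
     (nat \<Rightarrow> (nat \<Rightarrow> real) \<Rightarrow> real) \<Rightarrow> nat \<Rightarrow> (nat \<Rightarrow> real) \<Rightarrow> (nat \<Rightarrow> real) \<Rightarrow> ereal" where
  "stage_cost N I f V j w y =
     f j (local_vector N I j w y) +
     (\<Sum>i\<in>children N I j. ereal (V i (restrict y (coupling_idx N I i))))"

definition V_bar ::
    "nat \<Rightarrow> (nat \<Rightarrow> nat set) \<Rightarrow> (nat \<Rightarrow> (nat \<Rightarrow> real) \<Rightarrow> ereal) \<Rightarrow>
     (nat \<Rightarrow> (nat \<Rightarrow> real) set) \<Rightarrow> (nat \<Rightarrow> (nat \<Rightarrow> real) \<Rightarrow> real) \<Rightarrow>
     nat \<Rightarrow> (nat \<Rightarrow> real) \<Rightarrow> ereal" where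
  "V_bar N I f P V j w = (INF y\<in>{y. stage_constraint N I P j y}. stage_cost N I f V j w y)"

definition dom_V_bar ::
    "nat \<Rightarrow> (nat \<Rightarrow> nat set) \<Rightarrow> (nat \<Rightarrow> (nat \<Rightarrow> real) \<Rightarrow> ereal) \<Rightarrow>
     (nat \<Rightarrow> (nat \<Rightarrow> real) set) \<Rightarrow> (nat \<Rightarrow> (nat \<Rightarrow> real) \<Rightarrow> real) \<Rightarrow>
     nat \<Rightarrow> (nat \<Rightarrow> real) set" where
  "dom_V_bar N I f P V j = {w \<in> vec (coupling_idx N I j). V_bar N I f P V j w < \<infinity>}"

text \<open>
  Finiteness of the minimal cost is deliberately not part of this definition: that no minimizer met
  in the forward sweep has cost \<open>\<infinity>\<close> has to be proved.
\<close>

definition stage_minimizer ::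
    "nat \<Rightarrow> (nat \<Rightarrow> nat set) \<Rightarrow> (nat \<Rightarrow> (nat \<Rightarrow> real) \<Rightarrow> ereal) \<Rightarrow>
     (nat \<Rightarrow> (nat \<Rightarrow> real) set) \<Rightarrow> (nat \<Rightarrow> (nat \<Rightarrow> real) \<Rightarrow> real) \<Rightarrow>
     nat \<Rightarrow> (nat \<Rightarrow> real) \<Rightarrow> (nat \<Rightarrow> real) \<Rightarrow> bool" where
  "stage_minimizer N I f P V j w y \<longleftrightarrow>
     is_arg_min (stage_cost N I f V j w) (stage_constraint N I P j) y"


section \<open>Forward sweep\<close>

text \<open>
  A state of the sweep is the set \<open>D\<close> of subsystems solved so far together with their local vectors
  \<open>z i\<close>, \<open>i \<in> D\<close>. For the root, \<open>coupling_idx N I 1\<close> is empty, so \<open>received N I z 1\<close> is the empty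
  vector.
\<close>

definition ready :: "nat \<Rightarrow> (nat \<Rightarrow> nat set) \<Rightarrow> nat set \<Rightarrow> nat \<Rightarrow> bool" where
  "ready N I D j \<longleftrightarrow> j \<in> {1..N} - D \<and> (j = 1 \<or> parent N I j \<in> D)"

definition received :: "nat \<Rightarrow> (nat \<Rightarrow> nat set) \<Rightarrow> (nat \<Rightarrow> nat \<Rightarrow> real) \<Rightarrow> nat \<Rightarrow> (nat \<Rightarrow> real)" where
  "received N I z j = restrict (z (parent N I j)) (coupling_idx N I j)"

inductive forward_sweep ::
    "nat \<Rightarrow> (nat \<Rightarrow> nat set) \<Rightarrow> (nat \<Rightarrow> (nat \<Rightarrow> real) \<Rightarrow> ereal) \<Rightarrow>
     (nat \<Rightarrow> (nat \<Rightarrow> real) set) \<Rightarrow> (nat \<Rightarrow> (nat \<Rightarrow> real) \<Rightarrow> real) \<Rightarrow>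
     nat set \<Rightarrow> (nat \<Rightarrow> nat \<Rightarrow> real) \<Rightarrow> bool"
  for N I f P V where
  start: "forward_sweep N I f P V {} (\<lambda>_ _. undefined)"
| solve: "forward_sweep N I f P V (insert j D) (z(j := local_vector N I j (received N I z j) y))"
    if "forward_sweep N I f P V D z" and "ready N I D j"
      and "stage_minimizer N I f P V j (received N I z j) y"

text \<open>Components of \<open>x\<close> with an index in no \<open>I i\<close> are left arbitrary.\<close>

definition output_point ::
    "nat \<Rightarrow> nat \<Rightarrow> (nat \<Rightarrow> nat set) \<Rightarrow> (nat \<Rightarrow> nat \<Rightarrow> real) \<Rightarrow> (nat \<Rightarrow> real) \<Rightarrow> bool" where
  "output_point n N I z x \<longleftrightarrow> x \<in> vec {1..n} \<and> (\<forall>i\<in>{1..N}. restrict x (I i) = z i)"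

end

theory Submission
  imports Defs
begin

text \<open>
  The sweep keeps the invariant that every local vector computed so far lies in \<open>dom_F\<close>. The vector
  sent to a child \<open>j\<close> then lies in \<open>P j\<close>, that is, in the projection of \<open>dom_F j\<close>, so the stage
  problem of \<open>j\<close> has a point of finite cost and its minimizer has finite cost as well, which
  reproduces the invariant at \<open>j\<close>. At the root the projection of \<open>dom_F\<close> is nonempty because a
  feasible point restricts to an element of \<open>dom_F i\<close> for every \<open>i\<close>. Since the interaction graph has
  no triangles, every index lies in at most two of the sets \<open>I i\<close>; if in two, these belong to a
  subsystem and its parent, where the local vectors agree. Hence they glue to a global one.
\<close>

section \<open>Paths in undirected trees\<close>

text \<open>If \<open>u\<close> and \<open>v\<close> differed, going along \<open>u # p\<close> and
  back along \<open>v # q\<close> would link them while avoiding \<open>i\<close>; shortened to a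
  path and prefixed with \<open>i\<close>, this is a cycle.\<close>

lemma undirected_tree_second_vertex_unique:
  assumes tree: "undirected_tree G" and sym: "symmetric (with_proj G)"
    and p: "vpath (i # u # p) (with_proj G)" and q: "vpath (i # v # q) (with_proj G)"
    and last: "last (u # p) = last (v # q)"
  shows "u = v"
proof (rule ccontr)
  assume "u \<noteq> v"
  have iu: "(i, u) \<in> parcs G" "vwalk (u # p) (with_proj G)" "i \<notin> set (u # p)" "i \<in> pverts G"
    using p by (auto simp: vpath_def vwalk_def)
  have iv: "(i, v) \<in> parcs G" "vwalk (v # q) (with_proj G)" "i \<notin> set (v # q)"
    using q by (auto simp: vpath_def vwalk_def)
  define w where "w = (u # p) \<oplus> rev (v # q)"
  have "vwalk w (with_proj G)"
    unfolding w_def using iu iv last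
    by (intro vwalk_joinI_vwalk' vwalk_rev_ex sym) (auto simp: hd_rev)
  define r where "r = vwalk_to_vpath w"
  have r: "vpath r (with_proj G)"
    unfolding r_def by (rule vwalk_to_vpath_vpath) fact
  have hd_r: "hd r = u"
    unfolding r_def vwalk_to_vpath_hd by (simp add: w_def vwalk_join_def)
  have last_r: "last r = v"
  proof -
    have "last w = v"
    \<comment> \<open>Joining drops the head of \<open>rev (v # q)\<close>. For
      \<open>q = []\<close> nothing else is left, and \<open>v\<close> is the end of
      \<open>u # p\<close> by \<open>last\<close>.\<close>
    proof (cases "q = []")
      case True
      then show ?thesis using last by (simp add: w_def vwalk_join_def)
    next
      case False
      then have "tl (rev q @ [v]) = tl (rev q) @ [v]"
        by (simp add: tl_append2)
      then show ?thesis by (simp add: w_def vwalk_join_def)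
    qed
    then show ?thesis by (simp add: r_def vwalk_to_vpath_last)
  qed
  have "set w \<subseteq> set (u # p) \<union> set (v # q)"
    by (auto simp: w_def vwalk_join_def dest: list.set_sel(2)[rotated])
  then have "i \<notin> set r"
    using iu(3) iv(3) vwalk_to_vpath_subset[of i w] unfolding r_def by blast
  moreover have "vwalk (i # r) (with_proj G)"
    using r iu hd_r by (intro vwalk_consI) (auto simp: vpath_def)
  ultimately have "vpath (i # r) (with_proj G)"
    using r by (auto simp: vpath_def)
  moreover have "3 \<le> length (i # r)"
  proof -
    have "r \<noteq> []" using r by (auto simp: vpath_def)
    moreover have "length r \<noteq> 1" using hd_r last_r \<open>u \<noteq> v\<close> by (auto simp: length_Suc_conv)
    ultimately show ?thesis by (cases r) (auto simp: Suc_le_eq)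
  qed
  moreover have "(last (i # r), hd (i # r)) \<in> parcs G"
  proof -
    have "r \<noteq> []" using r by (auto simp: vpath_def)
    moreover have "(v, i) \<in> parcs G"
      using sym iv(1) by (auto simp: symmetric_def dest: symD)
    ultimately show ?thesis using last_r by simp
  qed
  ultimately show False
    using tree unfolding undirected_tree_def by blast
qed

section \<open>Parents and index sets\<close>

locale rooted_interaction_tree =
  fixes N :: nat and I :: "nat \<Rightarrow> nat set"
  assumes root: "1 \<in> {1..N}"
    and tree: "undirected_tree (interaction_graph N I)"
begin

abbreviation G :: "(nat, nat \<times> nat) pre_digraph" where
  "G \<equiv> with_proj (interaction_graph N I)"

lemma interaction_graph_simps [simp]:
  "pverts (interaction_graph N I) = {1..N}"
  "(i, j) \<in> parcs (interaction_graph N I) \<longleftrightarrow>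
     i \<in> {1..N} \<and> j \<in> {1..N} \<and> i \<noteq> j \<and> I i \<inter> I j \<noteq> {}"
  by (auto simp: interaction_graph_def)

lemma symmetric_G: "symmetric G"
  by (auto simp: symmetric_def sym_def)

lemma wf_digraph_G: "wf_digraph G"
proof
  fix e assume "e \<in> arcs G"
  then show "tail G e \<in> verts G" "head G e \<in> verts G" by (cases e; simp)+
qed

text \<open>Three distinct subsystems sharing an index are pairwise adjacent and form a triangle,
  the shortest cycle that \<open>undirected_tree\<close> excludes.\<close>

lemma index_in_at_most_two:
  assumes "{i, j, l} \<subseteq> {1..N}" "k \<in> I i" "k \<in> I j" "k \<in> I l"
  shows "i = j \<or> i = l \<or> j = l"
proof (rule ccontr)
  assume "\<not> ?thesis"
  then have "vpath [i, j, l] G" "(last [i, j, l], hd [i, j, l]) \<in> parcs (interaction_graph N I)"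
    using assms by (auto simp: vpath_def vwalk_def)
  then show False
    using tree unfolding undirected_tree_def by (metis One_nat_def length_Cons list.size(3) numeral_3_eq_3 order_refl)
qed

lemma ex_path_to_root:
  assumes "i \<in> {1..N}"
  obtains p where "vpath p G" "hd p = i" "last p = 1"
proof -
  interpret wf_digraph G by (rule wf_digraph_G)
  have "i \<rightarrow>\<^sup>*\<^bsub>with_proj (mk_symmetric G)\<^esub> 1"
    using tree assms root
    unfolding undirected_tree_def connected_def strongly_connected_def by auto
  \<comment> \<open>Connectivity is defined through the symmetric closure, which leaves reachability
    in the symmetric graph \<open>G\<close> unchanged.\<close>
  then have "i \<rightarrow>\<^sup>*\<^bsub>G\<^esub> 1"
    by (simp only: reachable_mk_symmetric_eq[OF symmetric_G])
  then show ?thesis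
    using that by (auto simp: reachable_vpath_conv)
qed

lemma parent_eqI:
  assumes "vpath (i # p # q) G" "last (i # p # q) = 1"
  shows "parent N I i = p"
  unfolding parent_def
proof (rule the_equality)
  show "\<exists>q. vpath (i # p # q) G \<and> last (i # p # q) = 1" using assms by blast
next
  fix u assume "\<exists>q. vpath (i # u # q) G \<and> last (i # u # q) = 1"
  then obtain r where "vpath (i # u # r) G" "last (u # r) = 1" by auto
  then show "u = p"
    using undirected_tree_second_vertex_unique[OF tree symmetric_G _ assms(1)] assms(2) by simp
qed

text \<open>Counted in vertices, so the root has depth 1. Taking the least length avoids proving
  that whole paths to the root are unique.\<close>

definition depth :: "nat \<Rightarrow> nat" where
  "depth i = (LEAST m. \<exists>p. vpath p G \<and> hd p = i \<and> last p = 1 \<and> length p = m)"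

text \<open>A shortest path from \<open>i\<close> to the root has the parent as second vertex;
  removing \<open>i\<close> leaves a shorter path for the parent.\<close>

lemma parent_properties:
  assumes i: "i \<in> {1..N}" "i \<noteq> 1"
  shows "parent N I i \<in> {1..N}" and "I (parent N I i) \<inter> I i \<noteq> {}"
    and "depth (parent N I i) < depth i"
proof -
  have "\<exists>m p. vpath p G \<and> hd p = i \<and> last p = 1 \<and> length p = m"
    using ex_path_to_root[OF i(1)] by metis
  then have "\<exists>p. vpath p G \<and> hd p = i \<and> last p = 1 \<and> length p = depth i"
    unfolding depth_def by (rule LeastI_ex)
  then obtain p where p: "vpath p G" "hd p = i" "last p = 1" "length p = depth i"
    by blast
  then obtain u q where pq: "p = i # u # q"
    using i(2) by (cases p; cases "tl p") (auto simp: vpath_def)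
  have parent: "parent N I i = u"
    using p pq by (intro parent_eqI[of i u q]) auto
  have arc: "(i, u) \<in> parcs (interaction_graph N I)" "vpath (u # q) G"
    using p(1) pq by (auto simp: vpath_def vwalk_def)
  then show "parent N I i \<in> {1..N}" "I (parent N I i) \<inter> I i \<noteq> {}"
    unfolding parent by auto
  have "depth u \<le> length (u # q)"
    unfolding depth_def by (rule Least_le) (use arc p pq in auto)
  then show "depth (parent N I i) < depth i"
    using p(4) pq parent by simp
qed

lemma parent_neq_self: "i \<in> {1..N} \<Longrightarrow> i \<noteq> 1 \<Longrightarrow> parent N I i \<noteq> i"
  using parent_properties(3)[of i] by (metis less_irrefl)

lemma parent_parent_neq_self:
  "\<lbrakk>i \<in> {1..N}; i \<noteq> 1; parent N I i \<noteq> 1\<rbrakk> \<Longrightarrow> parent N I (parent N I i) \<noteq> i"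
  using parent_properties(1,3)[of i] parent_properties(3)[of "parent N I i"]
  by (metis less_asym)

text \<open>Follow a path from \<open>i\<close> to the root. If it avoids \<open>j\<close>,
  prefixing \<open>j\<close> makes \<open>i\<close> the parent of \<open>j\<close>; if it meets
  \<open>j\<close>, jumping there directly makes \<open>j\<close> the parent of
  \<open>i\<close>.\<close>

lemma adjacent_imp_parent:
  assumes ij: "i \<in> {1..N}" "j \<in> {1..N}" "i \<noteq> j" "I i \<inter> I j \<noteq> {}"
  shows "i \<noteq> 1 \<and> parent N I i = j \<or> j \<noteq> 1 \<and> parent N I j = i"
proof -
  obtain p where p: "vpath p G" "hd p = i" "last p = 1"
    using ex_path_to_root[OF ij(1)] by blast
  then have p_ne: "p \<noteq> []" by (auto simp: vpath_def)
  show ?thesis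
  proof (cases "j \<in> set p")
    case False
    have "vwalk (j # p) G"
      using p p_ne ij by (intro vwalk_consI) (auto simp: vpath_def)
    then have "vpath (j # i # tl p) G" "last (j # i # tl p) = 1"
      using p p_ne False by (cases p; auto simp: vpath_def)+
    then have "parent N I j = i" by (rule parent_eqI)
    moreover have "j \<noteq> 1" using False p p_ne last_in_set by metis
    ultimately show ?thesis by blast
  next
    case True
    then obtain a b where ab: "p = a @ j # b" by (auto simp: in_set_conv_decomp)
    \<comment> \<open>As head of \<open>p\<close>, \<open>i\<close> comes before \<open>j\<close>,
      so distinctness of \<open>p\<close> keeps it out of \<open>j # b\<close>.\<close>
    have a: "i \<in> set a"
      using p(2) ij(3) ab by (cases a) auto
    have walk: "vwalk (j # b) G"
      using p(1) ab by (simp add: vpath_def vwalkI_append_r[of _ a])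
    have "i \<notin> set (j # b)" using a p(1) ab by (auto simp: vpath_def)
    moreover have "vwalk (i # j # b) G"
      using vwalk_consI[OF walk, of i] ij by simp
    ultimately have "vpath (i # j # b) G"
      using p(1) ab by (auto simp: vpath_def)
    moreover have "last (i # j # b) = 1" using p(3) ab by simp
    ultimately have "parent N I i = j" by (rule parent_eqI)
    moreover have "i \<noteq> 1"
      using \<open>i \<notin> set (j # b)\<close> p(3) ab
      by (metis last_appendR last_in_set list.distinct(1))
    ultimately show ?thesis by blast
  qed
qed

lemma childrenD:
  assumes "k \<in> children N I j"
  shows "k \<in> {1..N}" "k \<noteq> 1" "parent N I k = j"
  using assms by (auto simp: children_def)

lemma in_children_parent: "i \<in> {1..N} \<Longrightarrow> i \<noteq> 1 \<Longrightarrow> i \<in> children N I (parent N I i)"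
  by (simp add: children_def)

lemma coupling_idx_subset: "coupling_idx N I j \<subseteq> I j"
  by (auto simp: coupling_idx_def)

lemma coupling_idx_child_subset:
  "k \<in> children N I j \<Longrightarrow> coupling_idx N I k \<subseteq> I j"
  by (auto simp: coupling_idx_def children_def)

text \<open>A common index would belong to \<open>k\<close>, to \<open>j\<close> and to the parent
  of \<open>j\<close>, which are distinct because depth decreases towards the root.\<close>

lemma coupling_idx_child_disjoint:
  assumes k: "k \<in> children N I j" and j: "j \<in> {1..N}"
  shows "coupling_idx N I k \<inter> coupling_idx N I j = {}"
proof (cases "j = 1")
  case True
  then show ?thesis by (simp add: coupling_idx_def)
next
  case False
  note k = childrenD[OF k]
  have "k \<noteq> j" using parent_neq_self[OF k(1,2)] k(3) by metis
  moreover have "j \<noteq> parent N I j" using parent_neq_self[OF j False] by metis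
  moreover have "k \<noteq> parent N I j"
    using parent_parent_neq_self[OF k(1,2)] k(3) False by metis
  moreover have "{k, j, parent N I j} \<subseteq> {1..N}"
    using k(1) j parent_properties(1)[OF j False] by blast
  ultimately have "l \<notin> I k \<or> l \<notin> I j \<or> l \<notin> I (parent N I j)" for l
    using index_in_at_most_two[of k j "parent N I j" l] by metis
  moreover have "coupling_idx N I k = I j \<inter> I k" "coupling_idx N I j = I (parent N I j) \<inter> I j"
    using k(2,3) False by (simp_all add: coupling_idx_def)
  ultimately show ?thesis by blast
qed

text \<open>A nonlocal index is shared with a neighbour, and every neighbour is a child or the
  parent.\<close>

lemma local_indices_covered:
  assumes j: "j \<in> {1..N}"
  shows "I j \<subseteq> coupling_idx N I j \<union> decision_idx N I j"
proof
  fix k assume k: "k \<in> I j"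
  show "k \<in> coupling_idx N I j \<union> decision_idx N I j"
  proof (cases "k \<in> local_idx N I j")
    case True
    then show ?thesis by (simp add: decision_idx_def)
  next
    case False
    then obtain i where i: "i \<in> {1..N}" "i \<noteq> j" "k \<in> I i"
      using k unfolding local_idx_def by blast
    then consider "i \<noteq> 1" "parent N I i = j" | "j \<noteq> 1" "parent N I j = i"
      using adjacent_imp_parent[of i j] j k by (metis disjoint_iff)
    then show ?thesis
    proof cases
      case 1
      then have "i \<in> children N I j" "k \<in> coupling_idx N I i"
        using i k by (simp_all add: children_def coupling_idx_def)
      then show ?thesis by (auto simp: decision_idx_def)
    next
      case 2
      then show ?thesis using i k by (simp add: coupling_idx_def)
    qed
  qed
qed

lemma local_vector_restrict:
  assumes "j \<in> {1..N}" "x \<in> vec (I j)"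
  shows "local_vector N I j (restrict x (coupling_idx N I j)) (restrict x (decision_idx N I j)) = x"
proof
  fix k
  show "local_vector N I j (restrict x (coupling_idx N I j)) (restrict x (decision_idx N I j)) k = x k"
  proof (cases "k \<in> I j")
    case True
    then have "k \<in> coupling_idx N I j \<or> k \<in> decision_idx N I j"
      using local_indices_covered[OF assms(1)] by (meson UnE subsetD)
    then show ?thesis using True by (elim disjE) (simp_all add: local_vector_def override_on_def)
  next
    case False
    then show ?thesis using PiE_arb[OF assms(2) False] by (simp add: local_vector_def)
  qed
qed

lemma restrict_local_vector_coupling:
  assumes "w \<in> vec (coupling_idx N I j)"
  shows "restrict (local_vector N I j w y) (coupling_idx N I j) = w"
proof
  fix k
  show "restrict (local_vector N I j w y) (coupling_idx N I j) k = w k"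
  proof (cases "k \<in> coupling_idx N I j")
    case True
    then have "k \<in> I j" using coupling_idx_subset by blast
    then show ?thesis using True by (simp add: local_vector_def)
  next
    case False
    then show ?thesis using PiE_arb[OF assms False] by simp
  qed
qed

text \<open>\<open>override_on\<close> gives \<open>w\<close> priority over \<open>y\<close>;
  disjointness of the coupling sets keeps \<open>w\<close> away from what is sent to the
  child.\<close>

lemma restrict_local_vector_child:
  assumes "j \<in> {1..N}" "k \<in> children N I j"
  shows "restrict (local_vector N I j w y) (coupling_idx N I k) = restrict y (coupling_idx N I k)"
proof (rule restrict_ext)
  fix i assume "i \<in> coupling_idx N I k"
  then have "i \<in> I j" "i \<notin> coupling_idx N I j"
    using coupling_idx_child_subset[OF assms(2)] coupling_idx_child_disjoint[OF assms(2,1)] by blast+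
  then show "local_vector N I j w y i = y i" by (simp add: local_vector_def)
qed

section \<open>Stage problems\<close>

text \<open>The approximations \<open>V\<close> are real-valued, so however poor they are, they
  cannot change which decisions have infinite cost.\<close>

lemma stage_cost_eq_PInf_iff:
  "stage_cost N I f V j w y = \<infinity> \<longleftrightarrow> f j (local_vector N I j w y) = \<infinity>"
  by (auto simp: stage_cost_def sum_Pinfty)

text \<open>The decision components of a preimage of \<open>w\<close> in \<open>dom_F\<close>
  satisfy the stage constraints at finite cost. This brings received vectors under the assumption
  that minimizers exist.\<close>

lemma proj_dom_F_subset_dom_V_bar:
  assumes j: "j \<in> {1..N}"
  shows "proj (coupling_idx N I j) (dom_F N I f P j) \<subseteq> dom_V_bar N I f P V j"
proof
  fix w assume "w \<in> proj (coupling_idx N I j) (dom_F N I f P j)"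
  then obtain x where x: "x \<in> dom_F N I f P j" and w: "w = restrict x (coupling_idx N I j)"
    by (auto simp: proj_def)
  define y where "y = restrict x (decision_idx N I j)"
  have "restrict y (coupling_idx N I k) = restrict x (coupling_idx N I k)"
    if "k \<in> children N I j" for k
    using that by (intro restrict_ext) (auto simp: y_def decision_idx_def)
  moreover have "y \<in> vec (decision_idx N I j)" by (simp add: y_def)
  ultimately have "stage_constraint N I P j y"
    using x by (simp add: stage_constraint_def dom_F_def)
  moreover have "local_vector N I j w y = x"
    unfolding w y_def by (rule local_vector_restrict[OF j]) (use x in \<open>simp add: dom_F_def\<close>)
  then have "stage_cost N I f V j w y < \<infinity>"
    using x by (simp add: dom_F_def stage_cost_eq_PInf_iff)
  ultimately have "V_bar N I f P V j w < \<infinity>"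
    unfolding V_bar_def INF_less_iff by blast
  then show "w \<in> dom_V_bar N I f P V j"
    by (simp add: dom_V_bar_def w)
qed

text \<open>An infimum below \<infinity> provides a competitor \<open>y'\<close> of finite cost, and
  the minimizer costs no more.\<close>

lemma stage_minimizer_in_dom_F:
  assumes j: "j \<in> {1..N}" and w: "w \<in> dom_V_bar N I f P V j"
    and y: "stage_minimizer N I f P V j w y"
  shows "local_vector N I j w y \<in> dom_F N I f P j"
proof -
  have "V_bar N I f P V j w < \<infinity>"
    using w by (simp add: dom_V_bar_def)
  then obtain y' where y': "stage_constraint N I P j y'" "stage_cost N I f V j w y' < \<infinity>"
    unfolding V_bar_def INF_less_iff by blast
  have "stage_cost N I f V j w y \<le> stage_cost N I f V j w y'"
    using y y'(1) unfolding stage_minimizer_def is_arg_min_linorder by blast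
  then have "stage_cost N I f V j w y < \<infinity>"
    using y'(2) by (rule le_less_trans)
  then have "f j (local_vector N I j w y) < \<infinity>"
    by (simp add: stage_cost_eq_PInf_iff)
  moreover have "restrict (local_vector N I j w y) (coupling_idx N I k) \<in> P k"
    if "k \<in> children N I j" for k
    unfolding restrict_local_vector_child[OF j that]
    using y that unfolding stage_minimizer_def is_arg_min_def stage_constraint_def by blast
  moreover have "local_vector N I j w y \<in> vec (I j)"
    by (simp add: local_vector_def)
  ultimately show ?thesis
    unfolding dom_F_def by blast
qed

section \<open>Feasible points\<close>

lemma objective_eq_PInf_iff:
  "objective N I f x = \<infinity> \<longleftrightarrow> (\<exists>i\<in>{1..N}. f i (restrict x (I i)) = \<infinity>)"
  by (auto simp: objective_def sum_Pinfty)

text \<open>Induction from the leaves to the root: membership in \<open>dom_F\<close> for a child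
  puts the coupling components of \<open>x\<close> into its \<open>P\<close>.\<close>

lemma feasible_restrict_in_dom_F:
  assumes x: "feasible n N I f x" and P: "backward_sweep N I f P"
    and i: "i \<in> {1..N}"
  shows "restrict x (I i) \<in> dom_F N I f P i"
  using i
proof (induction "Max (depth ` {1..N}) - depth i" arbitrary: i rule: less_induct)
  case less
  have "restrict (restrict x (I i)) (coupling_idx N I k) \<in> P k" if k: "k \<in> children N I i" for k
  proof -
    note k' = childrenD[OF k]
    have "depth i < depth k" using parent_properties(3)[of k] k' by simp
    moreover have "depth k \<le> Max (depth ` {1..N})" using k' by simp
    ultimately have "Max (depth ` {1..N}) - depth k < Max (depth ` {1..N}) - depth i"
      by linarith
    then have "restrict x (I k) \<in> dom_F N I f P k"
      using k'(1) by (rule less.hyps)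
    then have "restrict (restrict x (I k)) (coupling_idx N I k) \<in> P k"
      using P k' unfolding backward_sweep_def proj_def by blast
    \<comment> \<open>The coupling indices of \<open>k\<close> lie in both \<open>I i\<close> and
      \<open>I k\<close>, so both double restrictions of \<open>x\<close> coincide.\<close>
    then show ?thesis
      using coupling_idx_subset[of k] coupling_idx_child_subset[OF k]
      by (simp add: restrict_restrict Int_absorb1)
  qed
  then show ?case
    using x less.prems by (auto simp: dom_F_def feasible_def objective_eq_PInf_iff)
qed

text \<open>An unsolved subsystem of least depth is the root or has a parent of smaller depth, which
  must already be solved.\<close>

lemma ready_exists:
  assumes "D \<subset> {1..N}"
  shows "\<exists>j. ready N I D j"
proof -
  obtain j where j: "j \<in> {1..N} - D"
    and min: "\<And>i. i \<in> {1..N} - D \<Longrightarrow> \<not> depth i < depth j"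
    using assms ex_has_least_nat[of "\<lambda>i. i \<in> {1..N} - D" _ depth] by (metis not_less psubset_imp_ex_mem)
  have "parent N I j \<in> D" if "j \<noteq> 1"
    using min parent_properties[of j] j that by blast
  then show ?thesis using j by (auto simp: ready_def)
qed

end

section \<open>The forward sweep\<close>

locale fp_adp = rooted_interaction_tree +
  fixes f :: "nat \<Rightarrow> (nat \<Rightarrow> real) \<Rightarrow> ereal"
    and P :: "nat \<Rightarrow> (nat \<Rightarrow> real) set"
    and V :: "nat \<Rightarrow> (nat \<Rightarrow> real) \<Rightarrow> real"
    and n :: nat
  assumes idx: "i \<in> {1..N} \<Longrightarrow> I i \<subseteq> {1..n}"
    and feas: "\<exists>x. feasible n N I f x"
    and sweep: "backward_sweep N I f P"
    and minimizer: "\<lbrakk>j \<in> {1..N}; w \<in> dom_V_bar N I f P V j\<rbrakk> \<Longrightarrow> \<exists>y. stage_minimizer N I f P V j w y"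
begin

text \<open>Closure of \<open>D\<close> under parents ensures that solving a further subsystem
  leaves all earlier received vectors unchanged.\<close>

definition sweep_invariant :: "nat set \<Rightarrow> (nat \<Rightarrow> nat \<Rightarrow> real) \<Rightarrow> bool" where
  "sweep_invariant D z \<longleftrightarrow> D \<subseteq> {1..N} \<and>
     (\<forall>j\<in>D. z j \<in> dom_F N I f P j \<and>
        (j \<noteq> 1 \<longrightarrow> parent N I j \<in> D \<and> restrict (z j) (coupling_idx N I j) = received N I z j))"

lemma received_in_dom_V_bar:
  assumes inv: "sweep_invariant D z" and ready: "ready N I D j"
  shows "received N I z j \<in> dom_V_bar N I f P V j"
proof -
  have j: "j \<in> {1..N}" using ready by (simp add: ready_def)
  have "received N I z j \<in> proj (coupling_idx N I j) (dom_F N I f P j)"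
  proof (cases "j = 1")
    case True
    obtain x where "feasible n N I f x" using feas by blast
    then have "restrict x (I 1) \<in> dom_F N I f P 1"
      by (intro feasible_restrict_in_dom_F[OF _ sweep root])
    then show ?thesis
      \<comment> \<open>Restricted to the empty coupling set of the root, every vector is the
        constant \<open>undefined\<close>, whatever \<open>parent N I 1\<close> may be.\<close>
      unfolding proj_def True by (rule rev_image_eqI) (simp add: received_def coupling_idx_def restrict_def)
  next
    case False
    then have "parent N I j \<in> D" using ready by (simp add: ready_def)
    then have "z (parent N I j) \<in> dom_F N I f P (parent N I j)"
      using inv by (simp add: sweep_invariant_def)
    then have "received N I z j \<in> P j"
      using in_children_parent[OF j False] by (auto simp: dom_F_def received_def)
    then show ?thesis
      using sweep j False unfolding backward_sweep_def by blast
  qed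
  then show ?thesis using proj_dom_F_subset_dom_V_bar[OF j] by blast
qed

lemma forward_sweep_invariant:
  assumes "forward_sweep N I f P V D z"
  shows "sweep_invariant D z"
  using assms
proof induction
  case start
  show ?case by (simp add: sweep_invariant_def)
next
  case (solve D z j y)
  let ?w = "received N I z j"
  have j: "j \<in> {1..N}" "j \<notin> D" "j \<noteq> 1 \<Longrightarrow> parent N I j \<in> D"
    using solve.hyps(2) by (auto simp: ready_def)
  have dom: "local_vector N I j ?w y \<in> dom_F N I f P j"
    by (rule stage_minimizer_in_dom_F[OF j(1) received_in_dom_V_bar[OF solve.IH solve.hyps(2)]
        solve.hyps(3)])
  have w: "restrict (local_vector N I j ?w y) (coupling_idx N I j) = ?w"
    by (rule restrict_local_vector_coupling) (simp add: received_def)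
  let ?z = "z(j := local_vector N I j ?w y)"
  \<comment> \<open>The update is at \<open>j\<close>, which is outside \<open>D\<close> and hence
    not the parent of \<open>k\<close>.\<close>
  have same: "received N I ?z k = received N I z k" if "parent N I k \<in> D" for k
    using that j(2) by (auto simp: received_def)
  show ?case
    using solve.IH j dom w same unfolding sweep_invariant_def by auto
qed

lemma stage_minimizer_exists:
  assumes "forward_sweep N I f P V D z" "ready N I D j"
  shows "\<exists>y. stage_minimizer N I f P V j (received N I z j) y"
  using minimizer received_in_dom_V_bar[OF forward_sweep_invariant] assms
  by (auto simp: ready_def)

text \<open>Induction on the number of solved subsystems leaves their order open; \<open>N\<close>
  of them exhaust \<open>{1..N}\<close>.\<close>

lemma forward_sweep_completes: "\<exists>z. forward_sweep N I f P V {1..N} z"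
proof -
  have "\<exists>D z. forward_sweep N I f P V D z \<and> card D = m" if "m \<le> N" for m
    using that
  proof (induction m)
    case 0
    show ?case using forward_sweep.start by fastforce
  next
    case (Suc m)
    then obtain D z where D: "forward_sweep N I f P V D z" "card D = m" by auto
    have sub: "D \<subseteq> {1..N}"
      using forward_sweep_invariant[OF D(1)] by (simp add: sweep_invariant_def)
    moreover have "D \<noteq> {1..N}" using D(2) Suc.prems by auto
    ultimately obtain j where j: "ready N I D j" using ready_exists by blast
    then have "\<exists>z. forward_sweep N I f P V (insert j D) z"
      using stage_minimizer_exists[OF D(1) j] forward_sweep.solve[OF D(1) j] by blast
    moreover have "card (insert j D) = Suc m"
      using D(2) j finite_subset[OF sub] by (simp add: ready_def)
    ultimately show ?case by blast
  qed
  then obtain D z where D: "forward_sweep N I f P V D z" "card D = N" by blast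
  then have "D = {1..N}"
    using forward_sweep_invariant[OF D(1)]
    by (intro card_subset_eq) (auto simp: sweep_invariant_def)
  then show ?thesis using D by blast
qed

text \<open>Subsystems sharing an index are equal or parent and child, and the child keeps the
  components received from its parent.\<close>

lemma local_vectors_agree:
  assumes z: "sweep_invariant {1..N} z"
    and ij: "i \<in> {1..N}" "j \<in> {1..N}" and k: "k \<in> I i" "k \<in> I j"
  shows "z i k = z j k"
proof -
  have child: "z i k = z (parent N I i) k"
    if "i \<in> {1..N}" "i \<noteq> 1" "k \<in> I i" "k \<in> I (parent N I i)" for i
  proof -
    have "restrict (z i) (coupling_idx N I i) k = received N I z i k"
      using z that by (simp add: sweep_invariant_def)
    then show ?thesis using that by (simp add: received_def coupling_idx_def)
  qed
  consider "i = j" | "i \<noteq> 1" "parent N I i = j" | "j \<noteq> 1" "parent N I j = i"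
    using adjacent_imp_parent[OF ij] k by blast
  then show ?thesis
    using child ij k by cases auto
qed

lemma output_point_exists:
  assumes "forward_sweep N I f P V {1..N} z"
  shows "\<exists>x. output_point n N I z x"
proof -
  have inv: "sweep_invariant {1..N} z" by (rule forward_sweep_invariant) fact
  \<comment> \<open>Any subsystem containing \<open>k\<close> may supply the component, since the
    local vectors agree; without one, the value is arbitrary.\<close>
  define x where "x = restrict (\<lambda>k. z (SOME i. i \<in> {1..N} \<and> k \<in> I i) k) {1..n}"
  have "restrict x (I i) = z i" if i: "i \<in> {1..N}" for i
  proof
    fix k
    show "restrict x (I i) k = z i k"
    proof (cases "k \<in> I i")
      case True
      define i' where "i' = (SOME i. i \<in> {1..N} \<and> k \<in> I i)"
      have "i' \<in> {1..N} \<and> k \<in> I i'"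
        unfolding i'_def by (rule someI[of _ i]) (use i True in blast)
      then have "z i' k = z i k"
        using local_vectors_agree[OF inv _ i _ True] by blast
      then show ?thesis using True idx[OF i] by (auto simp: x_def i'_def)
    next
      case False
      then show ?thesis
        using inv i by (auto simp: sweep_invariant_def dom_F_def PiE_def extensional_def)
    qed
  qed
  moreover have "x \<in> vec {1..n}" by (simp add: x_def)
  ultimately show ?thesis unfolding output_point_def by blast
qed

lemma output_point_feasible:
  assumes "forward_sweep N I f P V {1..N} z" "output_point n N I z x"
  shows "feasible n N I f x"
  using forward_sweep_invariant[OF assms(1)] assms(2)
  by (auto simp: feasible_def output_point_def objective_eq_PInf_iff sweep_invariant_def dom_F_def)

end

text \<open>The four conjuncts spell out that the algorithm generates a feasible point: the sweep
  never gets stuck, it can be completed, its local vectors form a point, and this point is feasible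
  for every choice of minimizers and processing order.\<close>

theorem theorem2:
  fixes n N :: nat
    and I :: "nat \<Rightarrow> nat set"
    and f :: "nat \<Rightarrow> (nat \<Rightarrow> real) \<Rightarrow> ereal"
    and P :: "nat \<Rightarrow> (nat \<Rightarrow> real) set"
    and V :: "nat \<Rightarrow> (nat \<Rightarrow> real) \<Rightarrow> real"
  assumes "1 \<in> {1..N}"
    and "\<And>i. i \<in> {1..N} \<Longrightarrow> I i \<subseteq> {1..n}"
    and "\<And>i x. i \<in> {1..N} \<Longrightarrow> x \<in> vec (I i) \<Longrightarrow> f i x \<noteq> -\<infinity>"
    and "\<exists>x. feasible n N I f x"
    and "undirected_tree (interaction_graph N I)"
    and "backward_sweep N I f P"
    and "\<And>j w. j \<in> {1..N} \<Longrightarrow> w \<in> dom_V_bar N I f P V j \<Longrightarrow> \<exists>y. stage_minimizer N I f P V j w y"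
  shows "(\<forall>D z j. forward_sweep N I f P V D z \<and> ready N I D j \<longrightarrow>
            (\<exists>y. stage_minimizer N I f P V j (received N I z j) y))
       \<and> (\<exists>z. forward_sweep N I f P V {1..N} z)
       \<and> (\<forall>z. forward_sweep N I f P V {1..N} z \<longrightarrow> (\<exists>x. output_point n N I z x))
       \<and> (\<forall>z x. forward_sweep N I f P V {1..N} z \<and> output_point n N I z x \<longrightarrow> feasible n N I f x)"
proof -
  interpret fp_adp N I f P V n
    by unfold_locales (use assms in blast)+
  show ?thesis
    using stage_minimizer_exists forward_sweep_completes output_point_exists output_point_feasible
    by blast
qed

end
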